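(* Let $d\in\mathbb{N}$ and let $(\mathbb{M},\mathbb{L},T)\in\mathcal{T}^d$, where $T$ is not centrally symmetric. Suppose that $W(T,\mathbb{L})$ contains linearly independent vectors $u_1,\ldots,u_d$ and a vector $u_{d+1}$ that is not parallel to any of the vectors $u_1,\ldots,u_d$. Then there exists a set $S\subseteq\mathbb{L}$ that is not centrally symmetric, finite, $d$-dimensional and $\mathbb{L}$-convex, and such that each facet of $\mathrm{conv}(S)$ has an outer normal vector in $\{\pm u_1,\ldots,\pm u_{d+1}\}$. Moreover, for each such $S$, the sets $S\oplus T$ and $S\oplus(-T)$ form a pair of nontrivially homometric $\mathbb{M}$-convex sets.
   Context: $\mathbb{N}=\{1,2,3,\ldots\}$; $o$ is the origin of $\mathbb{R}^d$; $\langle\cdot,\cdot\rangle$ is the standard scalar product; $X+Y=\{x+y: x\in X,\ y\in Y\}$, $-X=\{-x:x\in X\}$. The dimension of $X\subseteq\mathbb{R}^d$ is the maximal number of affinely independent points in $X$ minus $1$. The sum $X+Y$ is called direct, and is then written $X\oplus Y$, if each $z\in X+Y$ has a unique representation $z=x+y$ with $x\in X$, $y\in Y$. A lattice of rank $i$ in $\mathbb{R}^d$ is a set $\mathbb{Z}b_1+\cdots+\mathbb{Z}b_i$ with $b_1,\ldots,b_i$ linearly independent. For a lattice $\mathbb{M}$ of rank $d$ in $\mathbb{R}^d$, a subset $K\subseteq\mathbb{M}$ is $\mathbb{M}$-convex if $K=C\cap\mathbb{M}$ for some convex $C\subseteq\mathbb{R}^d$. $\mathcal{T}^d$ is the set of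 all triples $(\mathbb{M},\mathbb{L},T)$ such that $\mathbb{M}$ and $\mathbb{L}$ are lattices of rank $d$ in $\mathbb{R}^d$ with $\mathbb{L}\subseteq\mathbb{M}$, $T$ is a nonempty finite $\mathbb{M}$-convex set, and $\mathbb{M}=\mathbb{L}\oplus T$. The dual lattice is $\mathbb{L}^\ast=\{y\in\mathbb{R}^d:\langle y,x\rangle\in\mathbb{Z}\text{ for each }x\in\mathbb{L}\}$. The width function is $w(K,u)=\sup_{x\in K}\langle u,x\rangle-\inf_{x\in K}\langle u,x\rangle$, and $W(K,\mathbb{L})=\{u\in\mathbb{L}^\ast\setminus\{o\}: w(K,u)<1\}$. A set $K\subseteq\mathbb{R}^d$ is centrally symmetric if $K=2c-K$ for some $c\in\mathbb{R}^d$. For a finite $K\subseteq\mathbb{R}^d$ the covariogram is $g_K(u)=|K\cap(K+u)|$, $u\in\mathbb{R}^d$. Two finite sets $K,L$ are homometric if $g_K=g_L$; trivially homometric if they coincide up to translations and point reflections (i.e. $L=K+t$ for some $t\in\mathbb{R}^d$ or $L=2c-K$ for some $c\in\mathbb{R}^d$); nontrivially homometric if they are homometric but not trivially homometric. *)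

theory Defs
  imports "HOL-Analysis.Analysis" "HOL-Library.Set_Algebras"
begin

(* X + Y on sets is the Minkowski sum of Set_Algebras.  The point reflection -X is written
   uminus ` X, since - X on sets is the complement. *)

definition direct_sum :: "'a::ab_group_add set \<Rightarrow> 'a set \<Rightarrow> bool" where
  "direct_sum X Y \<longleftrightarrow> (\<forall>z\<in>X + Y. \<exists>!p. p \<in> X \<times> Y \<and> z = fst p + snd p)"

definition lattice_of_rank :: "nat \<Rightarrow> 'a::real_vector set \<Rightarrow> bool" where
  "lattice_of_rank i \<Lambda> \<longleftrightarrow>
     (\<exists>B. finite B \<and> card B = i \<and> independent B \<and>
          \<Lambda> = {\<Sum>b\<in>B. of_int (k b) *\<^sub>R b | k :: 'a \<Rightarrow> int. True})"

definition lattice_convex :: "'a::real_vector set \<Rightarrow> 'a set \<Rightarrow> bool" where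
  "lattice_convex M K \<longleftrightarrow> (\<exists>C. convex C \<and> K = C \<inter> M)"

definition tiling_triples :: "((real^'n) set \<times> (real^'n) set \<times> (real^'n) set) set" where
  "tiling_triples =
     {(M, L, T). lattice_of_rank CARD('n) M \<and> lattice_of_rank CARD('n) L \<and> L \<subseteq> M \<and>
                 T \<noteq> {} \<and> finite T \<and> lattice_convex M T \<and> direct_sum L T \<and> M = L + T}"

definition dual_lattice :: "'a::real_inner set \<Rightarrow> 'a set" where
  "dual_lattice L = {y. \<forall>x\<in>L. y \<bullet> x \<in> \<int>}"

(* Sup and Inf are those of the reals, so this is the width only for nonempty bounded K. *)
definition width :: "'a::real_inner set \<Rightarrow> 'a \<Rightarrow> real" where
  "width K u = (SUP x\<in>K. u \<bullet> x) - (INF x\<in>K. u \<bullet> x)"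

definition small_width_vectors :: "'a::real_inner set \<Rightarrow> 'a set \<Rightarrow> 'a set" where
  "small_width_vectors K L = {u \<in> dual_lattice L - {0}. width K u < 1}"

definition parallel :: "'a::real_vector \<Rightarrow> 'a \<Rightarrow> bool" where
  "parallel u v \<longleftrightarrow> (\<exists>c. u = c *\<^sub>R v) \<or> (\<exists>c. v = c *\<^sub>R u)"

definition centrally_symmetric :: "'a::real_vector set \<Rightarrow> bool" where
  "centrally_symmetric K \<longleftrightarrow> (\<exists>c. K = (\<lambda>x. 2 *\<^sub>R c - x) ` K)"

definition covariogram :: "'a::ab_group_add set \<Rightarrow> 'a \<Rightarrow> nat" where
  "covariogram K u = card (K \<inter> (\<lambda>x. x + u) ` K)"

definition homometric :: "'a::ab_group_add set \<Rightarrow> 'a set \<Rightarrow> bool" where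
  "homometric K L \<longleftrightarrow> finite K \<and> finite L \<and> covariogram K = covariogram L"

definition trivially_homometric :: "'a::real_vector set \<Rightarrow> 'a set \<Rightarrow> bool" where
  "trivially_homometric K L \<longleftrightarrow>
     (\<exists>t. L = (\<lambda>x. x + t) ` K) \<or> (\<exists>c. L = (\<lambda>x. 2 *\<^sub>R c - x) ` K)"

definition nontrivially_homometric :: "'a::real_vector set \<Rightarrow> 'a set \<Rightarrow> bool" where
  "nontrivially_homometric K L \<longleftrightarrow> homometric K L \<and> \<not> trivially_homometric K L"

definition outer_normal :: "'a::real_inner \<Rightarrow> 'a set \<Rightarrow> 'a set \<Rightarrow> bool" where
  "outer_normal v F P \<longleftrightarrow>
     v \<noteq> 0 \<and> (\<exists>b. P \<subseteq> {x. v \<bullet> x \<le> b} \<and> F = P \<inter> {x. v \<bullet> x = b})"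

definition admissible :: "(real^'n) set \<Rightarrow> (real^'n) set \<Rightarrow> (real^'n) set \<Rightarrow> bool" where
  "admissible L N S \<longleftrightarrow>
     S \<subseteq> L \<and> \<not> centrally_symmetric S \<and> finite S \<and> aff_dim S = int CARD('n) \<and>
     lattice_convex L S \<and>
     (\<forall>F. F facet_of (convex hull S) \<longrightarrow> (\<exists>v\<in>N. outer_normal v F (convex hull S)))"

end

theory Submission imports Defs begin

text \<open>
  The two sums have the same covariogram because the equation \<open>s + t = s' + t' + z\<close> turns into
  \<open>s - t' = s' - t + z\<close> when \<open>t\<close> and \<open>t'\<close> change sides. They are not related by a translation or a
  point reflection, because finite direct summands can be cancelled: such a relation would make \<open>T\<close>
  or \<open>S\<close> centrally symmetric. Cancellation follows by comparing the extreme terms in the direction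
  of the longest vector of the symmetric difference (\<open>direct_sum_cancel\<close>,
  \<open>nontrivially_homometric_direct_sums\<close>).

  Lattice convexity rests on rounding (\<open>lattice_convex_sum\<close>). Let \<open>m = l + t\<close> be a point of \<open>M\<close> in the
  hull of \<open>S + T\<close>. Each facet inequality of the hull of \<open>S\<close> can fail at \<open>l\<close> by at most the width of
  \<open>T\<close> in the direction of the facet normal, so by less than 1. For normals in the dual lattice all values
  concerned are integers, so it does not fail at all and \<open>l\<close> belongs to \<open>S\<close>. The same applies to \<open>-T\<close>,
  which has the same width.

  For the existence of \<open>S\<close>, the independent vectors \<open>u\<^sub>1, \<dots>, u\<^sub>d\<close> serve as coordinate functionals. After sign
  changes the last vector has nonnegative coefficients, at least two of them positive. In the coordinates
  with positive coefficients it bounds a simplex, and the product of this simplex with a cube in the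
  remaining coordinates is not centrally symmetric. Some multiple of the dual basis lies in \<open>L\<close>
  (\<open>lattice_dual_directions\<close>), so the edge lengths can be chosen such that all vertices are lattice points.
  Then the lattice points of the polytope have the polytope as their hull, and its facets have the prescribed
  normals (\<open>exists_admissible_simplex_prism\<close>, \<open>facet_of_Int_halfspaces\<close>).
\<close>

section \<open>Direct sums\<close>

lemma direct_sum_iff_inj_on:
  "direct_sum X Y \<longleftrightarrow> inj_on (\<lambda>p. fst p + snd p) (X \<times> Y)"
proof -
  have "X + Y = (\<lambda>p. fst p + snd p) ` (X \<times> Y)" by (force simp: set_plus_def)
  then have eq: "direct_sum X Y \<longleftrightarrow> (\<forall>q\<in>X \<times> Y. \<exists>!p. p \<in> X \<times> Y \<and> fst q + snd q = fst p + snd p)"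
    unfolding direct_sum_def by (simp only: ball_simps)
  show ?thesis
  proof
    assume "direct_sum X Y"
    then show "inj_on (\<lambda>p. fst p + snd p) (X \<times> Y)" unfolding eq by (intro inj_onI) blast
  next
    assume "inj_on (\<lambda>p. fst p + snd p) (X \<times> Y)"
    then show "direct_sum X Y" unfolding eq inj_on_def by blast
  qed
qed

lemma direct_sumI:
  assumes "\<And>x y x' y'. \<lbrakk>x \<in> X; y \<in> Y; x' \<in> X; y' \<in> Y; x + y = x' + y'\<rbrakk> \<Longrightarrow> x = x' \<and> y = y'"
  shows "direct_sum X Y"
  unfolding direct_sum_iff_inj_on by (rule inj_onI) (use assms in fastforce)

lemma direct_sumD:
  assumes "direct_sum X Y" "x \<in> X" "y \<in> Y" "x' \<in> X" "y' \<in> Y" "x + y = x' + y'"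
  shows "x = x' \<and> y = y'"
  using inj_onD[OF assms(1)[unfolded direct_sum_iff_inj_on], of "(x, y)" "(x', y')"] assms(2-)
  by simp

lemma direct_sum_subset: "direct_sum X Y \<Longrightarrow> X' \<subseteq> X \<Longrightarrow> direct_sum X' Y"
  unfolding direct_sum_iff_inj_on by (erule inj_on_subset) auto

text \<open>
  An equation \<open>x - y = x' - y'\<close> says the same as \<open>x + y' = x' + y\<close>, so reflecting one summand
  preserves uniqueness of representations.
\<close>

lemma direct_sum_uminus:
  assumes "direct_sum X Y"
  shows "direct_sum X (uminus ` Y)"
proof (rule direct_sumI)
  fix x y x' y'
  assume *: "x \<in> X" "y \<in> uminus ` Y" "x' \<in> X" "y' \<in> uminus ` Y" "x + y = x' + y'"
  then have "x + (- y') = x' + (- y)" by (simp add: algebra_simps)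
  with * direct_sumD[OF assms, of x "- y'" x' "- y"] show "x = x' \<and> y = y'" by auto
qed

lemma direct_sum_commute: "direct_sum X Y \<Longrightarrow> direct_sum Y X"
  by (rule direct_sumI) (metis add.commute direct_sumD)

text \<open>
  The heart of the cancellation law. A point \<open>p\<close> of largest norm in a set is, by the
  Cauchy-Schwarz inequality, the only maximizer of the functional \<open>x \<mapsto> p \<bullet> x\<close> on that set; so
  it plays the part of the leading term in a linear order. Choose \<open>t\<close> maximizing it on \<open>T\<close>. Writing \<open>p + t = s' + t'\<close> with \<open>s' \<in> B\<close> forces
  \<open>p \<bullet> s' \<ge> p \<bullet> p\<close>, hence \<open>s'\<close> lies outside the symmetric difference, so in \<open>A\<close> as well, and \<open>p + t\<close>
  has two representations in \<open>A \<oplus> T\<close>.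
\<close>

lemma no_norm_maximal_difference:
  fixes A B T :: "'a::real_inner set"
  assumes "finite T" "T \<noteq> {}" and dir: "direct_sum A T" and eq: "A + T = B + T"
    and p: "p \<in> A - B" and max: "\<And>q. q \<in> (A - B) \<union> (B - A) \<Longrightarrow> norm q \<le> norm p"
  shows False
proof -
  have "Max ((\<bullet>) p ` T) \<in> (\<bullet>) p ` T" using assms(1,2) by (intro Max_in) auto
  then obtain t where t: "t \<in> T" "Max ((\<bullet>) p ` T) = p \<bullet> t" by blast
  have tmax: "p \<bullet> t' \<le> p \<bullet> t" if "t' \<in> T" for t'
    using Max_ge[of "(\<bullet>) p ` T" "p \<bullet> t'"] assms(1) t that by auto
  have "p + t \<in> B + T" using p t(1) eq by blast
  then obtain s' t' where st: "s' \<in> B" "t' \<in> T" "p + t = s' + t'" by (auto elim: set_plus_elim)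
  have "s' \<noteq> p" using st(1) p by blast
  show False
  proof (cases "s' \<in> A")
    case True
    with direct_sumD[OF dir, of p t s' t'] p t st \<open>s' \<noteq> p\<close> show False by auto
  next
    case False
    then have "norm s' \<le> norm p" using st(1) max by blast
    have "p \<bullet> (p + t) = p \<bullet> (s' + t')" using st(3) by simp
    then have "p \<bullet> p \<le> p \<bullet> s'" using tmax[OF st(2)] by (simp add: inner_add_right)
    moreover have "s' \<bullet> s' \<le> p \<bullet> p" using \<open>norm s' \<le> norm p\<close> by (simp add: norm_le)
    moreover have "(p - s') \<bullet> (p - s') > 0" using \<open>s' \<noteq> p\<close> by simp
    ultimately show False by (simp add: inner_diff inner_commute)
  qed
qed

text \<open>
  For finite sets in an inner product space a direct summand can be cancelled. This expresses that
  the group ring of a torsion-free abelian group has no zero divisors, restricted to products of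
  indicator functions; the proof compares extreme terms in the same way.
\<close>

lemma direct_sum_cancel:
  fixes A B T :: "'a::real_inner set"
  assumes "finite A" "finite B" "finite T" "T \<noteq> {}"
    and "direct_sum A T" "direct_sum B T" "A + T = B + T"
  shows "A = B"
proof (rule ccontr)
  assume "A \<noteq> B"
  let ?D = "(A - B) \<union> (B - A)"
  have fin: "finite ?D" "?D \<noteq> {}" using assms(1,2) \<open>A \<noteq> B\<close> by auto
  then have "Max (norm ` ?D) \<in> norm ` ?D" by (intro Max_in) auto
  then obtain p where p: "p \<in> ?D" "Max (norm ` ?D) = norm p" by blast
  have max: "norm q \<le> norm p" if "q \<in> ?D" for q
    using Max_ge[of "norm ` ?D" "norm q"] fin p(2) that by auto
  show False
  proof (cases "p \<in> A - B")
    case True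
    show False
      by (rule no_norm_maximal_difference[OF assms(3,4,5,7) True]) (rule max)
  next
    case False
    show False
      by (rule no_norm_maximal_difference[OF assms(3,4,6) assms(7)[symmetric], of p])
        (use False p max in auto)
  qed
qed

section \<open>Homometry of direct sums\<close>

text \<open>
  The covariogram counts pairs of points with a given difference. Directness replaces each point
  by its pair of summands, which makes the roles of \<open>S\<close> and \<open>T\<close> separately visible.
\<close>

lemma covariogram_direct_sum_eq:
  assumes "direct_sum S T"
  shows "covariogram (S + T) z =
    card {(s, t, s', t'). s \<in> S \<and> t \<in> T \<and> s' \<in> S \<and> t' \<in> T \<and> s + t = s' + t' + z}"
    (is "_ = card ?Q")
proof -
  have "bij_betw (\<lambda>(s, t, s', t'). s + t) ?Q ((S + T) \<inter> (\<lambda>x. x + z) ` (S + T))"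
    unfolding bij_betw_def
  proof
    show "inj_on (\<lambda>(s, t, s', t'). s + t) ?Q"
    proof (rule inj_onI)
      fix p q
      assume "p \<in> ?Q" "q \<in> ?Q" and pq: "(\<lambda>(s, t, s', t'). s + t) p = (\<lambda>(s, t, s', t'). s + t) q"
      then obtain a b c d a' b' c' d' where
        *: "a \<in> S" "b \<in> T" "c \<in> S" "d \<in> T" "a' \<in> S" "b' \<in> T" "c' \<in> S" "d' \<in> T"
        and eq: "a + b = c + d + z" "a' + b' = c' + d' + z" "p = (a, b, c, d)" "q = (a', b', c', d')"
        by blast
      have ab: "a + b = a' + b'" using pq eq(3,4) by simp
      then have "c + d + z = c' + d' + z" using eq(1,2) by simp
      then have "c + d = c' + d'" by simp
      then show "p = q"
        using direct_sumD[OF assms, of c d c' d'] direct_sumD[OF assms, of a b a' b'] * ab eq(3,4) by simp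
    qed
    show "(\<lambda>(s, t, s', t'). s + t) ` ?Q = (S + T) \<inter> (\<lambda>x. x + z) ` (S + T)"
      by (force simp: set_plus_def image_def)
  qed
  then show ?thesis unfolding covariogram_def by (rule bij_betw_same_card[symmetric])
qed

text \<open>
  The equation \<open>s + t = s' + t' + z\<close> is the same as \<open>s - t' = s' - t + z\<close>, so exchanging and
  negating \<open>t\<close> and \<open>t'\<close> matches the two families of quadruples.
\<close>

lemma covariogram_reflect_summand:
  assumes "direct_sum S T"
  shows "covariogram (S + T) = covariogram (S + uminus ` T)"
proof
  fix z
  let ?Q = "\<lambda>T. {(s, t, s', t'). s \<in> S \<and> t \<in> T \<and> s' \<in> S \<and> t' \<in> T \<and> s + t = s' + t' + z}"
  have "bij_betw (\<lambda>(s, t, s', t'). (s, - t', s', - t)) (?Q T) (?Q (uminus ` T))"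
    by (rule bij_betwI[where g = "\<lambda>(s, t, s', t'). (s, - t', s', - t)"])
      (auto simp: algebra_simps)
  then show "covariogram (S + T) z = covariogram (S + uminus ` T) z"
    unfolding covariogram_direct_sum_eq[OF assms]
      covariogram_direct_sum_eq[OF direct_sum_uminus[OF assms]]
    by (rule bij_betw_same_card)
qed

text \<open>
  If \<open>S \<oplus> (-T)\<close> is a translate of \<open>S \<oplus> T\<close>, cancelling \<open>S\<close> shows that \<open>-T\<close> is a translate of \<open>T\<close>;
  if it is a reflection of \<open>S \<oplus> T\<close>, cancelling \<open>-T\<close> shows that \<open>S\<close> is a reflection of itself. Each
  contradicts one of the two asymmetry assumptions.
\<close>

lemma nontrivially_homometric_direct_sums:
  fixes S T :: "'a::real_inner set"
  assumes "finite S" "finite T" "S \<noteq> {}" "T \<noteq> {}" and dir: "direct_sum S T"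
    and "\<not> centrally_symmetric S" "\<not> centrally_symmetric T"
  shows "nontrivially_homometric (S + T) (S + uminus ` T)"
proof -
  note dir' = direct_sum_uminus[OF dir]
  have "homometric (S + T) (S + uminus ` T)"
    unfolding homometric_def
    using assms(1,2) covariogram_reflect_summand[OF dir] by (simp add: finite_set_plus)
  moreover have "S + uminus ` T \<noteq> (\<lambda>x. x + a) ` (S + T)" for a
  proof
    let ?T = "(\<lambda>x. x + a) ` T"
    assume "S + uminus ` T = (\<lambda>x. x + a) ` (S + T)"
    also have "\<dots> = S + ?T" by (auto simp: set_plus_def image_def add.assoc) metis+
    finally have "uminus ` T + S = ?T + S" by (simp add: add.commute)
    moreover have "direct_sum ?T S"
    proof (rule direct_sum_commute, rule direct_sumI)
      fix x y x' y' assume *: "x \<in> S" "y \<in> ?T" "x' \<in> S" "y' \<in> ?T" "x + y = x' + y'"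
      then have "x + (y - a) = x' + (y' - a)" by (simp add: algebra_simps)
      with direct_sumD[OF dir, of x "y - a" x' "y' - a"] * show "x = x' \<and> y = y'" by auto
    qed
    ultimately have "uminus ` T = ?T"
      using direct_sum_cancel[of "uminus ` T" ?T S] direct_sum_commute[OF dir'] assms(1-3)
      by blast
    then have "uminus ` uminus ` T = uminus ` ?T" by (rule arg_cong)
    moreover have "uminus ` uminus ` T = T" by (simp add: image_image)
    moreover have "uminus ` ?T = (\<lambda>x. 2 *\<^sub>R (- (1/2) *\<^sub>R a) - x) ` T"
      unfolding image_image by (rule image_cong) simp_all
    ultimately have "T = (\<lambda>x. 2 *\<^sub>R (- (1/2) *\<^sub>R a) - x) ` T" by metis
    then show False using \<open>\<not> centrally_symmetric T\<close> unfolding centrally_symmetric_def by blast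
  qed
  moreover have "S + uminus ` T \<noteq> (\<lambda>x. 2 *\<^sub>R c - x) ` (S + T)" for c
  proof
    let ?S = "(\<lambda>x. 2 *\<^sub>R c - x) ` S"
    assume "S + uminus ` T = (\<lambda>x. 2 *\<^sub>R c - x) ` (S + T)"
    also have "\<dots> = {2 *\<^sub>R c - (x + y) | x y. x \<in> S \<and> y \<in> T}"
      by (auto simp: set_plus_def)
    also have "\<dots> = {(2 *\<^sub>R c - x) + - y | x y. x \<in> S \<and> y \<in> T}" by (simp add: diff_diff_add)
    also have "\<dots> = ?S + uminus ` T" by (auto simp: set_plus_def; blast)
    finally have "S + uminus ` T = ?S + uminus ` T" .
    moreover have "direct_sum ?S (uminus ` T)"
    proof (rule direct_sumI)
      fix x y x' y'
      assume *: "x \<in> ?S" "y \<in> uminus ` T" "x' \<in> ?S" "y' \<in> uminus ` T" "x + y = x' + y'"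
      then have "(2 *\<^sub>R c - x) + - y = (2 *\<^sub>R c - x') + - y'" by (simp add: algebra_simps)
      with direct_sumD[OF dir, of "2 *\<^sub>R c - x" "- y" "2 *\<^sub>R c - x'" "- y'"] *
      show "x = x' \<and> y = y'" by auto
    qed
    ultimately have "S = ?S"
      using direct_sum_cancel[of S ?S "uminus ` T"] dir' assms(1,2,4) by blast
    then show False using \<open>\<not> centrally_symmetric S\<close> unfolding centrally_symmetric_def by blast
  qed
  ultimately show ?thesis
    unfolding nontrivially_homometric_def trivially_homometric_def by blast
qed

section \<open>Facets of full-dimensional polyhedra\<close>

text \<open>
  A full-dimensional polyhedron is the intersection of its facet half-spaces, for any choice of
  normals exposing the facets. A segment from an interior point \<open>p\<close> to a point outside \<open>P\<close> leaves
  \<open>P\<close> through some facet; the functional exposing that facet is strictly below its maximum at \<open>p\<close>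
  and equal to it at the exit point, so it exceeds the maximum beyond.
\<close>

lemma mem_polyhedron_if_facet_inequalities:
  fixes P :: "'a::euclidean_space set"
  assumes P: "polyhedron P" and int: "interior P \<noteq> {}"
    and facet: "\<And>F. F facet_of P \<Longrightarrow>
      \<exists>v b. P \<subseteq> {x. v \<bullet> x \<le> b} \<and> F = P \<inter> {x. v \<bullet> x = b} \<and> v \<bullet> l \<le> b"
  shows "l \<in> P"
proof (rule ccontr)
  assume "l \<notin> P"
  obtain p where p: "p \<in> interior P" using int by blast
  then have "p \<in> P" using interior_subset by blast
  then have "closed_segment p l \<inter> frontier P \<noteq> {}"
    using \<open>l \<notin> P\<close> by (intro connected_Int_frontier) auto
  then obtain q where q: "q \<in> closed_segment p l" "q \<in> frontier P" by blast
  have "closed P" using P by (rule polyhedron_imp_closed)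
  then have "q \<in> P" using q(2) frontier_subset_closed by blast
  have "rel_frontier P = frontier P"
    using int interior_rel_interior_gen[of P]
    by (auto simp: rel_frontier_def frontier_def split: if_splits)
  then obtain F where F: "F facet_of P" "q \<in> F"
    using q(2) rel_frontier_of_polyhedron[OF P] by auto
  obtain v b where vb: "P \<subseteq> {x. v \<bullet> x \<le> b}" "F = P \<inter> {x. v \<bullet> x = b}" "v \<bullet> l \<le> b"
    using facet[OF F(1)] by blast
  have "F \<inter> interior P = {}"
    using F(1) by (intro face_of_disjoint_interior facet_of_imp_face_of) auto
  then have "v \<bullet> p < b" using p vb \<open>p \<in> P\<close> by fastforce
  obtain t where t: "0 \<le> t" "t \<le> 1" "q = (1 - t) *\<^sub>R p + t *\<^sub>R l"
    using q(1) by (auto simp: in_segment)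
  have "t < 1" using t \<open>q \<in> P\<close> \<open>l \<notin> P\<close> by (cases "t = 1") auto
  have "v \<bullet> q = (1 - t) * (v \<bullet> p) + t * (v \<bullet> l)" using t(3) by (simp add: inner_add_right)
  also have "\<dots> < (1 - t) * b + t * b"
    using \<open>t < 1\<close> \<open>v \<bullet> p < b\<close> \<open>v \<bullet> l \<le> b\<close> t(1)
    by (intro add_less_le_mono mult_left_mono mult_strict_left_mono) auto
  finally show False using F(2) vb(2) by (simp add: algebra_simps)
qed

text \<open>
  The system \<open>H\<close> of inequalities may be redundant. A relative interior point of a facet is not
  interior to \<open>P\<close>, so some inequality of \<open>H\<close> is tight there. The face cut out by it contains the
  facet and is proper, and a facet is a maximal proper face for dimension reasons.
\<close>

lemma facet_of_Int_halfspaces: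
  fixes H :: "('a::euclidean_space \<times> real) set"
  assumes "finite H" and int: "interior P \<noteq> {}"
    and P: "P = {x. \<forall>(a, b)\<in>H. a \<bullet> x \<le> b}"
    and nz: "\<And>a b. (a, b) \<in> H \<Longrightarrow> a \<noteq> 0"
    and F: "F facet_of P"
  shows "\<exists>(a, b)\<in>H. F = P \<inter> {x. a \<bullet> x = b}"
proof -
  have P': "P = (\<Inter>(a, b)\<in>H. {x. a \<bullet> x \<le> b})" using P by auto
  have "convex P" unfolding P' by (intro convex_INT) (auto simp: convex_halfspace_le)
  have Fface: "F face_of P" and "F \<noteq> {}" "F \<noteq> P" using F by (auto simp: facet_of_def)
  then have "convex F" using face_of_imp_convex by blast
  then obtain z where z: "z \<in> rel_interior F" using \<open>F \<noteq> {}\<close> rel_interior_eq_empty by blast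
  then have "z \<in> F" using rel_interior_subset by blast
  then have "z \<in> P" using Fface face_of_imp_subset by blast
  have "z \<notin> interior P"
    using face_of_disjoint_interior[OF Fface \<open>F \<noteq> P\<close>] \<open>z \<in> F\<close> by blast
  have "\<exists>(a, b)\<in>H. a \<bullet> z = b"
  proof (rule ccontr)
    assume none: "\<not> ?thesis"
    let ?U = "\<Inter>(a, b)\<in>H. {x. a \<bullet> x < b}"
    have "open ?U" using \<open>finite H\<close> by (intro open_INT) (auto simp: open_halfspace_lt)
    moreover have "?U \<subseteq> P" unfolding P' by fastforce
    moreover have "z \<in> ?U" using none \<open>z \<in> P\<close> unfolding P by fastforce
    ultimately show False using \<open>z \<notin> interior P\<close> interior_maximal by blast
  qed
  then obtain a b where ab: "(a, b) \<in> H" "a \<bullet> z = b" by blast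
  let ?G = "P \<inter> {x. a \<bullet> x = b}"
  have Gface: "?G face_of P"
    using ab(1) unfolding P by (intro face_of_Int_supporting_hyperplane_le)
      (use \<open>convex P\<close> P in auto)
  have "F \<subseteq> ?G"
  proof (rule subset_of_face_of[OF Gface])
    show "F \<subseteq> P" using Fface face_of_imp_subset by blast
    show "?G \<inter> rel_interior F \<noteq> {}" using z ab \<open>z \<in> P\<close> by blast
  qed
  then have "F face_of ?G" using face_of_subset[OF Fface] by blast
  have "?G \<noteq> P"
  proof
    assume "?G = P"
    then have "interior P \<subseteq> interior {x. a \<bullet> x = b}" by (intro interior_mono) blast
    then show False using int nz[OF ab(1)] by (simp add: interior_hyperplane)
  qed
  then have "aff_dim ?G < aff_dim P" using \<open>convex P\<close> Gface face_of_aff_dim_lt by blast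
  then have "\<not> aff_dim F < aff_dim ?G" using F by (simp add: facet_of_def)
  then have "F = ?G" using face_of_aff_dim_lt[OF _ \<open>F face_of ?G\<close>] Gface face_of_imp_convex by blast
  with ab(1) show ?thesis by blast
qed

section \<open>Lattices and lattice width\<close>

lemma lattice_of_rank_closed:
  assumes "lattice_of_rank i \<Lambda>"
  shows lattice_zero: "0 \<in> \<Lambda>"
    and lattice_add: "\<And>x y. x \<in> \<Lambda> \<Longrightarrow> y \<in> \<Lambda> \<Longrightarrow> x + y \<in> \<Lambda>"
    and lattice_scale: "\<And>x (m::int). x \<in> \<Lambda> \<Longrightarrow> of_int m *\<^sub>R x \<in> \<Lambda>"
proof -
  obtain B where B: "\<Lambda> = {\<Sum>b\<in>B. of_int (k b) *\<^sub>R b | k :: 'a \<Rightarrow> int. True}"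
    using assms unfolding lattice_of_rank_def by blast
  show "0 \<in> \<Lambda>" unfolding B by (rule CollectI, rule exI[of _ "\<lambda>_. 0"]) simp
  show "x + y \<in> \<Lambda>" if xy: "x \<in> \<Lambda>" "y \<in> \<Lambda>" for x y
  proof -
    obtain k :: "'a \<Rightarrow> int" where x: "x = (\<Sum>b\<in>B. of_int (k b) *\<^sub>R b)"
      using xy(1) unfolding B by blast
    obtain l :: "'a \<Rightarrow> int" where y: "y = (\<Sum>b\<in>B. of_int (l b) *\<^sub>R b)"
      using xy(2) unfolding B by blast
    from x y have "x + y = (\<Sum>b\<in>B. of_int (k b + l b) *\<^sub>R b)"
      by (simp add: sum.distrib scaleR_add_left)
    then show ?thesis unfolding B by (intro CollectI exI[of _ "\<lambda>b. k b + l b"]) simp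
  qed
  show "of_int m *\<^sub>R x \<in> \<Lambda>" if x: "x \<in> \<Lambda>" for x and m :: int
  proof -
    obtain k :: "'a \<Rightarrow> int" where "x = (\<Sum>b\<in>B. of_int (k b) *\<^sub>R b)"
      using x unfolding B by blast
    then have "of_int m *\<^sub>R x = (\<Sum>b\<in>B. of_int (m * k b) *\<^sub>R b)"
      by (simp add: scaleR_sum_right)
    then show ?thesis unfolding B by (intro CollectI exI[of _ "\<lambda>b. m * k b"]) simp
  qed
qed

lemma lattice_uminus: "lattice_of_rank i \<Lambda> \<Longrightarrow> x \<in> \<Lambda> \<Longrightarrow> - x \<in> \<Lambda>"
  using lattice_scale[of i \<Lambda> x "-1"] by simp

lemma lattice_sum:
  assumes "lattice_of_rank i \<Lambda>" "\<And>j. j \<in> J \<Longrightarrow> f j \<in> \<Lambda>"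
  shows "(\<Sum>j\<in>J. f j) \<in> \<Lambda>"
  using assms(2)
  by (induction J rule: infinite_finite_induct)
    (auto intro: lattice_zero[OF assms(1)] lattice_add[OF assms(1)])

lemma uminus_image_lattice:
  assumes "lattice_of_rank i \<Lambda>"
  shows "uminus ` \<Lambda> = \<Lambda>"
  using lattice_uminus[OF assms] by (force simp: image_iff intro: bexI[of _ "- _"])

lemma small_width_uminus:
  assumes "finite T" "T \<noteq> {}" "v \<in> small_width_vectors T L"
  shows "- v \<in> small_width_vectors T L" "v \<in> small_width_vectors (uminus ` T) L"
proof -
  have d: "width T v = Max ((\<bullet>) v ` T) - Min ((\<bullet>) v ` T)"
    and d': "width T (- v) = Max ((\<bullet>) (- v) ` T) - Min ((\<bullet>) (- v) ` T)"
    and d'': "width (uminus ` T) v = Max ((\<lambda>x. - (v \<bullet> x)) ` T) - Min ((\<lambda>x. - (v \<bullet> x)) ` T)"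
    using assms(1,2) by (simp_all add: width_def cSup_eq_Max cInf_eq_Min image_image)
  have eq: "(\<lambda>x. - (v \<bullet> x)) ` T = uminus ` ((\<bullet>) v ` T)" "(\<bullet>) (- v) ` T = uminus ` ((\<bullet>) v ` T)"
    by (auto simp: image_image)
  have "Max (uminus ` ((\<bullet>) v ` T)) = - Min ((\<bullet>) v ` T)"
    "Min (uminus ` ((\<bullet>) v ` T)) = - Max ((\<bullet>) v ` T)"
    using assms(1,2) by (simp_all add: minus_Min_eq_Max minus_Max_eq_Min)
  then have "width T (- v) = width T v" "width (uminus ` T) v = width T v"
    unfolding d d' d'' eq by simp_all
  then show "- v \<in> small_width_vectors T L" "v \<in> small_width_vectors (uminus ` T) L"
    using assms(3) by (auto simp: small_width_vectors_def dual_lattice_def)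
qed

lemma small_width_bound:
  assumes "finite T" "v \<in> small_width_vectors T L" "s \<in> T" "t \<in> T"
  shows "v \<bullet> s < v \<bullet> t + 1"
proof -
  have "v \<bullet> s \<le> (SUP x\<in>T. v \<bullet> x)" "(INF x\<in>T. v \<bullet> x) \<le> v \<bullet> t"
    using assms by (auto intro: cSUP_upper cINF_lower bdd_above_finite bdd_below_finite)
  then show ?thesis using assms(2) by (simp add: small_width_vectors_def width_def)
qed

section \<open>Lattice convexity of the sum\<close>

text \<open>
  Let \<open>m = l + t\<close> be a point of \<open>M\<close> in the hull of \<open>S + T\<close>, and let \<open>v \<bullet> x \<le> b\<close> be the inequality of a
  facet of the hull of \<open>S\<close>. The value \<open>v \<bullet> m\<close> is at most \<open>b\<close> plus the maximum of \<open>v\<close> on \<open>T\<close>, which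
  is below \<open>b + v \<bullet> t + 1\<close> because \<open>T\<close> has width less than 1. So \<open>v \<bullet> l < b + 1\<close>; both sides are
  integers since \<open>v\<close> is in the dual lattice and the facet contains a point of \<open>S\<close>. Thus \<open>l\<close> satisfies all
  facet inequalities and lies in \<open>S\<close>. This is the step where small width is used.
\<close>

lemma lattice_convex_sum:
  fixes M L T S :: "'a::euclidean_space set"
  assumes M: "M = L + T" and "finite T" and S: "S \<subseteq> L" "finite S" "lattice_convex L S"
    and full: "interior (convex hull S) \<noteq> {}"
    and facets: "\<And>F. F facet_of (convex hull S) \<Longrightarrow>
      \<exists>v\<in>small_width_vectors T L. outer_normal v F (convex hull S)"
  shows "lattice_convex M (S + T)"
proof -
  let ?P = "convex hull S"
  have "S + T \<subseteq> M" unfolding M using S(1) by (intro set_plus_mono2) auto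
  have "m \<in> S + T" if m: "m \<in> convex hull (S + T)" "m \<in> M" for m
  proof -
    obtain l t where lt: "l \<in> L" "t \<in> T" "m = l + t" using m(2) M by (auto elim: set_plus_elim)
    have "l \<in> ?P"
    proof (rule mem_polyhedron_if_facet_inequalities[OF _ full])
      show "polyhedron ?P"
        by (intro polytope_imp_polyhedron polytope_convex_hull \<open>finite S\<close>)
      fix F assume F: "F facet_of ?P"
      obtain v b where v: "v \<in> small_width_vectors T L" and b: "?P \<subseteq> {x. v \<bullet> x \<le> b}"
        and Feq: "F = ?P \<inter> {x. v \<bullet> x = b}"
        using facets[OF F] unfolding outer_normal_def by blast
      have dual: "v \<bullet> x \<in> \<int>" if "x \<in> L" for x
        using v that by (simp add: small_width_vectors_def dual_lattice_def)
      have "\<exists>s\<in>S. v \<bullet> s = b"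
      proof (rule ccontr)
        assume "\<not> ?thesis"
        then have "S \<subseteq> {x. v \<bullet> x < b}" using b hull_subset[of S convex] by fastforce
        then have "?P \<subseteq> {x. v \<bullet> x < b}" by (intro hull_minimal convex_halfspace_lt)
        then show False using F Feq by (auto simp: facet_of_def)
      qed
      then have "b \<in> \<int>" using dual S(1) by blast
      have "S + T \<subseteq> {x. v \<bullet> x < b + v \<bullet> t + 1}"
      proof
        fix x assume "x \<in> S + T"
        then obtain s t' where x: "s \<in> S" "t' \<in> T" "x = s + t'" by (auto elim: set_plus_elim)
        have "v \<bullet> s \<le> b" using x(1) b hull_subset[of S convex] by fastforce
        with small_width_bound[OF \<open>finite T\<close> v x(2) lt(2)] x(3)
        show "x \<in> {x. v \<bullet> x < b + v \<bullet> t + 1}" by (simp add: inner_add_right)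
      qed
      then have "convex hull (S + T) \<subseteq> {x. v \<bullet> x < b + v \<bullet> t + 1}"
        by (intro hull_minimal convex_halfspace_lt)
      then have "v \<bullet> l < b + 1" using m(1) lt(3) by (auto simp: inner_add_right)
      moreover have "v \<bullet> l \<in> \<int>" using dual lt(1) by blast
      ultimately have "v \<bullet> l \<le> b" using \<open>b \<in> \<int>\<close> by (auto elim!: Ints_cases)
      with b Feq show "\<exists>v b. ?P \<subseteq> {x. v \<bullet> x \<le> b} \<and> F = ?P \<inter> {x. v \<bullet> x = b} \<and> v \<bullet> l \<le> b"
        by blast
    qed
    moreover obtain C where "convex C" "S = C \<inter> L" using S(3) unfolding lattice_convex_def by blast
    moreover from this have "?P \<subseteq> C" by (intro hull_minimal) auto
    ultimately have "l \<in> S" using lt(1) by blast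
    then show ?thesis using lt by blast
  qed
  then have "S + T = convex hull (S + T) \<inter> M"
    using \<open>S + T \<subseteq> M\<close> hull_subset[of "S + T" convex] by blast
  then show ?thesis unfolding lattice_convex_def using convex_convex_hull by blast
qed

section \<open>Dual directions in a lattice\<close>

lemma span_range_eq_UNIV:
  fixes v :: "'n::finite \<Rightarrow> real^'n"
  assumes "inj v" "independent (range v)"
  shows "span (range v) = UNIV"
proof -
  have "card (range v) = CARD('n)" using \<open>inj v\<close> by (simp add: card_image)
  then show ?thesis
    using card_ge_dim_independent[of "range v" UNIV] assms(2) by (auto simp: dim_UNIV)
qed

lemma det_Ints:
  fixes A :: "real^'n^'n"
  assumes "\<And>i j. A $ i $ j \<in> \<int>"
  shows "det A \<in> \<int>"
  unfolding det_def by (intro Ints_sum Ints_mult Ints_prod assms) auto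

text \<open>
  The basis dual to \<open>v\<close> need not lie in \<open>L\<close>, but a common multiple of it does: with respect to a
  basis of \<open>L\<close> the functionals \<open>v i\<close> have an integer matrix \<open>A\<close>, and by the rule of Cramer the
  matrix \<open>det A\<close> times the inverse of \<open>A\<close> is integral. Hence \<open>k = \<bar>det A\<bar>\<close> works.
\<close>

lemma lattice_dual_directions:
  fixes L :: "(real^'n) set" and v :: "'n \<Rightarrow> real^'n"
  assumes L: "lattice_of_rank CARD('n) L" and dual: "\<And>i. v i \<in> dual_lattice L"
    and "inj v" "independent (range v)"
  obtains W k where "\<And>i. W i \<in> L" "k > 0" "\<And>i j. v i \<bullet> W j = (if i = j then k else 0)"
proof -
  obtain B where B: "finite B" "card B = CARD('n)" "independent B"
    and LB: "L = {\<Sum>b\<in>B. of_int (k b) *\<^sub>R b | k :: real^'n \<Rightarrow> int. True}"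
    using L unfolding lattice_of_rank_def by blast
  obtain \<beta> :: "'n \<Rightarrow> real^'n" where \<beta>: "bij_betw \<beta> UNIV B"
    using B finite_same_card_bij[of "UNIV :: 'n set" B] by auto
  have inj\<beta>: "inj \<beta>" and range\<beta>: "range \<beta> = B" using \<beta> by (auto simp: bij_betw_def)
  have \<beta>L: "\<beta> j \<in> L" for j
  proof -
    have "(\<Sum>b\<in>B. of_int (if b = \<beta> j then 1 else 0) *\<^sub>R b) = \<beta> j"
      using sum.delta[OF B(1), of "\<beta> j" "\<lambda>b. b"] rangeI[of \<beta> j, unfolded range\<beta>]
      by (simp add: if_distrib[of real_of_int] if_distrib[of "\<lambda>c. c *\<^sub>R _"] cong: if_cong)
    then show ?thesis unfolding LB by (intro CollectI exI[of _ "\<lambda>b. if b = \<beta> j then 1 else 0"]) simp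
  qed
  define A :: "real^'n^'n" where "A = (\<chi> i j. v i \<bullet> \<beta> j)"
  \<comment> \<open>\<open>A\<close> maps coordinates with respect to \<open>\<beta>\<close> to the values of the functionals \<open>v i\<close>.\<close>
  have A_mult: "(A *v x) $ i = v i \<bullet> (\<Sum>j\<in>UNIV. (x $ j) *\<^sub>R \<beta> j)" for x i
    by (simp add: A_def matrix_vector_mult_def inner_sum_right mult.commute)
  note span = span_range_eq_UNIV[OF \<open>inj v\<close> \<open>independent (range v)\<close>]
  have "x = 0" if "A *v x = 0" for x
  proof -
    let ?y = "\<Sum>j\<in>UNIV. (x $ j) *\<^sub>R \<beta> j"
    have orth: "orthogonal ?y w" if "w \<in> range v" for w
      using \<open>A *v x = 0\<close> A_mult[of x] that by (auto simp: orthogonal_def inner_commute)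
    have "orthogonal ?y ?y"
      by (rule orthogonal_to_span[where S = "range v"]) (use span orth in auto)
    then have "?y = 0" by (simp add: orthogonal_def)
    have "(\<Sum>b\<in>B. (x $ inv \<beta> b) *\<^sub>R b) = (\<Sum>j\<in>UNIV. (x $ inv \<beta> (\<beta> j)) *\<^sub>R \<beta> j)"
      using sum.reindex_bij_betw[OF \<beta>, of "\<lambda>b. (x $ inv \<beta> b) *\<^sub>R b"] by simp
    also have "\<dots> = ?y" using inj\<beta> by simp
    finally have "(\<Sum>b\<in>B. (x $ inv \<beta> b) *\<^sub>R b) = 0" using \<open>?y = 0\<close> by simp
    then have "\<forall>b\<in>B. x $ inv \<beta> b = 0"
      using \<open>independent B\<close> independentD[OF B(3) B(1) subset_refl, of "\<lambda>b. x $ inv \<beta> b"] by blast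
    then have "x $ j = 0" for j using range\<beta> inj\<beta> by (metis inv_f_f rangeI)
    then show "x = 0" by (simp add: vec_eq_iff)
  qed
  then have "det A \<noteq> 0"
    by (metis invertible_det_nz invertible_left_inverse matrix_left_invertible_ker)
  have A_int: "A $ i $ j \<in> \<int>" for i j
    using dual[of i] \<beta>L[of j] by (simp add: A_def dual_lattice_def)
  \<comment> \<open>Column \<open>j\<close> of the inverse of \<open>A\<close>, in the form given by the rule of Cramer.\<close>
  define X :: "'n \<Rightarrow> real^'n" where
    "X j = (\<chi> k. det (\<chi> p q. if q = k then axis j 1 $ p else A $ p $ q) / det A)" for j
  have AX: "A *v X j = axis j 1" for j
    using cramer[OF \<open>det A \<noteq> 0\<close>, of "X j" "axis j 1"] by (simp add: X_def)
  define D where "D = \<bar>det A\<bar>"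
  define W where "W j = (\<Sum>k\<in>UNIV. (D * X j $ k) *\<^sub>R \<beta> k)" for j
  have DX_int: "D * X j $ k \<in> \<int>" for j k
  proof -
    have "det (\<chi> p q. if q = k then axis j 1 $ p else A $ p $ q) \<in> \<int>"
      by (rule det_Ints) (auto simp: axis_def A_int)
    moreover have "D * X j $ k = sgn (det A) * det (\<chi> p q. if q = k then axis j 1 $ p else A $ p $ q)"
      using \<open>det A \<noteq> 0\<close> by (simp add: D_def X_def abs_sgn field_simps)
    ultimately show ?thesis by (auto simp: sgn_if)
  qed
  have "W j \<in> L" for j
    unfolding W_def
  proof (rule lattice_sum[OF L])
    fix k
    obtain m :: int where "D * X j $ k = of_int m" using DX_int Ints_cases by blast
    then show "(D * X j $ k) *\<^sub>R \<beta> k \<in> L" using lattice_scale[OF L \<beta>L] by simp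
  qed
  moreover have "D > 0" using \<open>det A \<noteq> 0\<close> by (simp add: D_def)
  moreover have "v i \<bullet> W j = (if i = j then D else 0)" for i j
  proof -
    have "W j = D *\<^sub>R (\<Sum>k\<in>UNIV. X j $ k *\<^sub>R \<beta> k)" by (simp add: W_def scaleR_sum_right)
    then have "v i \<bullet> W j = D * (A *v X j) $ i" using A_mult by simp
    then show ?thesis by (simp add: AX axis_def)
  qed
  ultimately show ?thesis using that by blast
qed

section \<open>Existence of an admissible set\<close>

lemma admissible_mono: "admissible L N S \<Longrightarrow> N \<subseteq> N' \<Longrightarrow> admissible L N' S"
  unfolding admissible_def by blast

text \<open>
  In the coordinates \<open>v i \<bullet> x\<close> the functional \<open>g\<close> has nonnegative coefficients, and \<open>I\<close> is its
  support. The polytope \<open>P\<close> of all \<open>x\<close> with \<open>v i \<bullet> x \<ge> 0\<close> for every \<open>i\<close>, \<open>v i \<bullet> x \<le> k\<close> for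
  \<open>i \<notin> I\<close> and \<open>g \<bullet> x \<le> h\<close> is a simplex in the coordinates from \<open>I\<close> times a cube in the others. Its
  vertices are sums of \<open>0\<close> or one point \<open>(h / (g \<bullet> W i)) W i\<close> with \<open>i \<in> I\<close>, and of vectors \<open>0\<close> or \<open>W i\<close> with
  \<open>i \<notin> I\<close>. The values \<open>g \<bullet> W i\<close> are integers, so choosing \<open>h\<close> as the product of the positive ones puts all
  vertices into \<open>L\<close>, and \<open>P\<close> is the hull of \<open>S = P \<inter> L\<close>. Since \<open>I\<close> has at least two elements, the simplex
  factor has dimension at least 2, which excludes central symmetry.
\<close>

lemma exists_admissible_simplex_prism:
  fixes L :: "(real^'n) set" and v W :: "'n \<Rightarrow> real^'n" and g :: "real^'n"
  assumes L: "lattice_of_rank CARD('n) L"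
    and v_dual: "\<And>i. v i \<in> dual_lattice L" and g_dual: "g \<in> dual_lattice L"
    and W: "\<And>i. W i \<in> L" and "k > 0" and vW: "\<And>i j. v i \<bullet> W j = (if i = j then k else 0)"
    and gW: "\<And>i. g \<bullet> W i \<ge> 0" and ij: "i0 \<noteq> j0" "g \<bullet> W i0 > 0" "g \<bullet> W j0 > 0"
  shows "\<exists>S. admissible L (insert g (range v \<union> uminus ` range v)) S"
proof -
  define m where "m i = g \<bullet> W i" for i
  define I where "I = {i. m i > 0}"
  define h where "h = (\<Prod>i\<in>I. m i)"
  have m0: "m i = 0" if "i \<notin> I" for i using that gW[of i] by (simp add: I_def m_def)
  have mpos: "m i > 0" if "i \<in> I" for i using that by (simp add: I_def)
  have "h > 0" unfolding h_def by (intro prod_pos) (simp add: mpos)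
  have mint: "m i \<in> \<int>" for i using g_dual W[of i] by (simp add: m_def dual_lattice_def)
  have hint: "h / m i \<in> \<int>" if "i \<in> I" for i
  proof -
    have "h = m i * (\<Prod>j\<in>I - {i}. m j)" unfolding h_def using that by (intro prod.remove) auto
    then have "h / m i = (\<Prod>j\<in>I - {i}. m j)" using mpos[OF that] by simp
    then show ?thesis using mint by (simp add: Ints_prod)
  qed
  have coord_comb: "v i \<bullet> (\<Sum>j\<in>UNIV. c j *\<^sub>R W j) = c i * k" for c i
    by (simp add: inner_sum_right vW if_distrib cong: if_cong)
  have W_ne: "W i \<noteq> 0" for i using vW[of i i] \<open>k > 0\<close> by auto
  have injW: "inj W" by (rule injI) (metis vW \<open>k > 0\<close> less_irrefl)
  have indW: "independent (range W)"
  proof (rule independent_if_scalars_zero)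
    show "finite (range W)" by simp
    fix f w assume s: "(\<Sum>x\<in>range W. f x *\<^sub>R x) = 0" and "w \<in> range W"
    then obtain i where i: "w = W i" by blast
    have "(\<Sum>j\<in>UNIV. f (W j) *\<^sub>R W j) = 0" using s injW by (simp add: sum.reindex)
    then have "f (W i) * k = 0" using coord_comb[of i "\<lambda>j. f (W j)"] by simp
    then show "f w = 0" using i \<open>k > 0\<close> by simp
  qed
  have expand: "x = (\<Sum>i\<in>UNIV. ((v i \<bullet> x) / k) *\<^sub>R W i)" for x
  proof -
    have "x \<in> span (range W)" using span_range_eq_UNIV[OF injW indW] by simp
    then obtain f where "x = (\<Sum>w\<in>range W. f w *\<^sub>R w)" by (auto simp: span_finite)
    then have x: "x = (\<Sum>j\<in>UNIV. f (W j) *\<^sub>R W j)" using injW by (simp add: sum.reindex)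
    have "v i \<bullet> x = f (W i) * k" for i using coord_comb[of i "\<lambda>j. f (W j)"] x by simp
    then show ?thesis using x \<open>k > 0\<close> by simp
  qed
  have g_expand: "g \<bullet> x = (\<Sum>i\<in>I. ((v i \<bullet> x) / k) * m i)" for x
  proof -
    have "g \<bullet> x = (\<Sum>i\<in>UNIV. ((v i \<bullet> x) / k) * m i)"
      by (subst expand[of x]) (simp add: inner_sum_right m_def)
    also have "\<dots> = (\<Sum>i\<in>I. ((v i \<bullet> x) / k) * m i)"
      by (rule sum.mono_neutral_right) (auto simp: m0)
    finally show ?thesis .
  qed
  define P where "P = {x. (\<forall>i. 0 \<le> v i \<bullet> x) \<and> (\<forall>i. i \<notin> I \<longrightarrow> v i \<bullet> x \<le> k) \<and> g \<bullet> x \<le> h}"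
  define S where "S = P \<inter> L"
  define p where "p i = (h / m i) *\<^sub>R W i" for i
  have vp: "v i \<bullet> p j = (if i = j then h / m j * k else 0)" for i j by (simp add: p_def vW)
  have gp: "g \<bullet> p i = h" if "i \<in> I" for i using mpos[OF that] by (simp add: p_def m_def)
  have pL: "p i \<in> L" if i: "i \<in> I" for i
  proof -
    obtain z :: int where "h / m i = of_int z" using hint[OF i] Ints_cases by blast
    then show ?thesis unfolding p_def using lattice_scale[OF L W] by simp
  qed
  \<comment> \<open>Every vertex of the product of the simplex and the cube belongs to \<open>S\<close>.\<close>
  have vertex: "q + (\<Sum>i\<in>- I. s i) \<in> S"
    if q: "q \<in> insert 0 (p ` I)" and s: "\<forall>i\<in>- I. s i \<in> {0, W i}" for q s
  proof -
    let ?x = "q + (\<Sum>i\<in>- I. s i)"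
    have s_cases: "s j = 0 \<or> s j = W j" if "j \<notin> I" for j using s that by blast
    have "q \<in> L" using q pL lattice_zero[OF L] by auto
    moreover have "(\<Sum>i\<in>- I. s i) \<in> L"
    proof (rule lattice_sum[OF L])
      show "s j \<in> L" if "j \<in> - I" for j
        using s_cases[of j] that W[of j] lattice_zero[OF L] by auto
    qed
    ultimately have "?x \<in> L" by (rule lattice_add[OF L])
    have vs: "v i \<bullet> s j = (if i = j \<and> s j \<noteq> 0 then k else 0)" if "j \<notin> I" for i j
      using s_cases[OF that] vW[of i j] W_ne[of j] by auto
    have vsum: "v i \<bullet> (\<Sum>j\<in>- I. s j) = (if i \<notin> I \<and> s i \<noteq> 0 then k else 0)" for i
    proof -
      have "v i \<bullet> (\<Sum>j\<in>- I. s j) = (\<Sum>j\<in>- I. if i = j then (if s i \<noteq> 0 then k else 0) else 0)"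
        unfolding inner_sum_right by (intro sum.cong) (auto simp: vs)
      also have "\<dots> = (if i \<notin> I \<and> s i \<noteq> 0 then k else 0)" by simp
      finally show ?thesis .
    qed
    have q0: "0 \<le> v i \<bullet> q" and q1: "i \<notin> I \<Longrightarrow> v i \<bullet> q = 0" for i
      using q mpos \<open>h > 0\<close> \<open>k > 0\<close> by (auto simp: vp less_imp_le)
    have "g \<bullet> q \<le> h" using q gp \<open>h > 0\<close> by auto
    moreover have "g \<bullet> (\<Sum>i\<in>- I. s i) = 0" unfolding g_expand by (simp add: vsum)
    ultimately have "?x \<in> P"
      using q0 q1 \<open>k > 0\<close> unfolding P_def by (auto simp: inner_add_right vsum)
    then show ?thesis using \<open>?x \<in> L\<close> by (simp add: S_def)
  qed
  have zS: "0 \<in> S" using vertex[of 0 "\<lambda>_. 0"] by simp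
  have pS: "p i \<in> S" if "i \<in> I" for i using vertex[of "p i" "\<lambda>_. 0"] that by simp
  have WS: "W i \<in> S" if "i \<notin> I" for i
    using vertex[of 0 "\<lambda>j. if j = i then W i else 0"] that by simp
  define H where "H = (\<lambda>i. (- v i, 0)) ` UNIV \<union> (\<lambda>i. (v i, k)) ` (- I) \<union> {(g, h)}"
  have PH: "P = {x. \<forall>(a, b)\<in>H. a \<bullet> x \<le> b}"
    by (auto simp: P_def H_def ball_Un)
  have "convex P"
  proof -
    have "P = (\<Inter>(a, b)\<in>H. {x. a \<bullet> x \<le> b})" unfolding PH by auto
    also have "convex \<dots>" by (intro convex_INT) (auto simp: convex_halfspace_le)
    finally show ?thesis .
  qed
  have hullS: "convex hull S = P"
  proof
    show "convex hull S \<subseteq> P" using \<open>convex P\<close> by (intro hull_minimal) (auto simp: S_def)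
    show "P \<subseteq> convex hull S"
    proof
      fix x assume x: "x \<in> P"
      define q where "q = (\<Sum>i\<in>I. ((v i \<bullet> x) / k) *\<^sub>R W i)"
      have split: "x = q + (\<Sum>i\<in>- I. ((v i \<bullet> x) / k) *\<^sub>R W i)"
        unfolding q_def
        by (subst sum.union_disjoint[symmetric]) (use expand[of x] in \<open>auto simp: Compl_partition\<close>)
      \<comment> \<open>Barycentric coordinates of the simplex component \<open>q\<close> with respect to the points \<open>p i\<close>;
        the remaining weight belongs to the vertex 0.\<close>
      define c where "c i = (v i \<bullet> x) / k * m i / h" for i
      have c0: "c i \<ge> 0" if "i \<in> I" for i
        using x mpos[OF that] \<open>k > 0\<close> \<open>h > 0\<close> by (simp add: c_def P_def)
      have "sum c I = g \<bullet> x / h" unfolding c_def g_expand by (simp only: sum_divide_distrib)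
      then have csum: "sum c I \<le> 1" using x \<open>h > 0\<close> by (simp add: P_def)
      have "q = (1 - sum c I) *\<^sub>R 0 + (\<Sum>i\<in>I. c i *\<^sub>R p i)"
      proof -
        have "((v i \<bullet> x) / k) *\<^sub>R W i = c i *\<^sub>R p i" if "i \<in> I" for i
          using \<open>h > 0\<close> mpos[OF that] by (simp add: c_def p_def)
        then show ?thesis by (simp add: q_def)
      qed
      also have "\<dots> \<in> convex hull insert 0 (p ` I)"
      proof -
        \<comment> \<open>The index \<open>None\<close> stands for the vertex 0.\<close>
        let ?c = "\<lambda>i. case i of None \<Rightarrow> 1 - sum c I | Some i \<Rightarrow> c i"
        let ?q = "\<lambda>i. case i of None \<Rightarrow> 0 | Some i \<Rightarrow> p i"
        have "(\<Sum>i\<in>insert None (Some ` I). ?c i *\<^sub>R ?q i) \<in> convex hull insert 0 (p ` I)"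
          by (rule convex_sum)
            (auto simp: c0 csum sum.reindex hull_inc)
        then show ?thesis by (simp add: sum.reindex)
      qed
      finally have q: "q \<in> convex hull insert 0 (p ` I)" .
      have seg: "((v i \<bullet> x) / k) *\<^sub>R W i \<in> convex hull {0, W i}" if "i \<in> - I" for i
      proof -
        have "0 \<le> (v i \<bullet> x) / k" "(v i \<bullet> x) / k \<le> 1" using x that \<open>k > 0\<close> by (auto simp: P_def)
        then have "((v i \<bullet> x) / k) *\<^sub>R W i \<in> closed_segment 0 (W i)"
          unfolding in_segment by (intro exI[of _ "(v i \<bullet> x) / k"]) simp
        then show ?thesis by (simp add: segment_convex_hull)
      qed
      have r: "(\<Sum>i\<in>- I. ((v i \<bullet> x) / k) *\<^sub>R W i) \<in> (\<Sum>i\<in>- I. convex hull {0, W i})"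
        using seg by (subst set_sum_alt) auto
      have "x \<in> convex hull (insert 0 (p ` I)) + (\<Sum>i\<in>- I. convex hull {0, W i})"
        using set_plus_intro[OF q r] by (simp only: split[symmetric])
      then have "x \<in> convex hull (insert 0 (p ` I) + (\<Sum>i\<in>- I. {0, W i}))"
        by (simp only: convex_hull_set_plus convex_hull_set_sum)
      moreover have "insert 0 (p ` I) + (\<Sum>i\<in>- I. {0, W i}) \<subseteq> S"
      proof
        fix y assume "y \<in> insert 0 (p ` I) + (\<Sum>i\<in>- I. {0, W i})"
        then obtain q' r where "y = q' + r" "q' \<in> insert 0 (p ` I)" "r \<in> (\<Sum>i\<in>- I. {0, W i})"
          by (rule set_plus_elim)
        moreover from this(3) obtain s where "r = sum s (- I)" "\<forall>i\<in>- I. s i \<in> {0, W i}"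
          by (subst (asm) set_sum_alt) auto
        ultimately show "y \<in> S" using vertex by blast
      qed
      ultimately show "x \<in> convex hull S" using hull_mono by blast
    qed
  qed
  have "finite S"
  proof -
    \<comment> \<open>A crude bound for all coordinates at once: the points of \<open>S\<close> have integer
      coordinates between 0 and \<open>b\<close>.\<close>
    define b where "b = k + (\<Sum>i\<in>I. h / m i * k)"
    have bound: "v i \<bullet> x \<le> b" if x: "x \<in> P" for x i
    proof (cases "i \<in> I")
      case False
      have "0 \<le> (\<Sum>i\<in>I. h / m i * k)"
        using mpos \<open>h > 0\<close> \<open>k > 0\<close> by (intro sum_nonneg) (simp add: less_imp_le)
      with False x show ?thesis by (auto simp: b_def P_def)
    next
      case True
      have "(v i \<bullet> x) / k * m i \<le> g \<bullet> x"
        unfolding g_expand using x mpos \<open>k > 0\<close> True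
        by (intro member_le_sum) (auto simp: P_def less_imp_le)
      then have "(v i \<bullet> x) / k * m i \<le> h" using x by (simp add: P_def)
      then have "v i \<bullet> x \<le> h / m i * k" using mpos[OF True] \<open>k > 0\<close> by (simp add: field_simps)
      also have "\<dots> \<le> (\<Sum>i\<in>I. h / m i * k)"
        using mpos True \<open>h > 0\<close> \<open>k > 0\<close> by (intro member_le_sum) (auto simp: less_imp_le)
      finally show ?thesis using \<open>k > 0\<close> by (simp add: b_def)
    qed
    let ?Y = "{z. z \<in> \<int> \<and> 0 \<le> z \<and> z \<le> b}"
    let ?f = "\<lambda>y :: 'n \<Rightarrow> real. \<Sum>i\<in>UNIV. (y i / k) *\<^sub>R W i"
    have "S \<subseteq> ?f ` (PiE UNIV (\<lambda>_. ?Y))"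
    proof
      fix x assume x: "x \<in> S"
      have "v i \<bullet> x \<in> ?Y" for i
        using x bound[of x i] v_dual[of i] by (auto simp: S_def P_def dual_lattice_def)
      then show "x \<in> ?f ` (PiE UNIV (\<lambda>_. ?Y))"
        using expand[of x] by (intro image_eqI[of _ _ "\<lambda>i. v i \<bullet> x"]) auto
    qed
    moreover have "finite ?Y" by (rule finite_int_segment)
    ultimately show ?thesis
      by (elim finite_subset) (intro finite_imageI finite_PiE, simp_all)
  qed
  have "aff_dim S = int CARD('n)"
  proof -
    have "W i \<in> span S" for i
    proof (cases "i \<in> I")
      case True
      then have "(m i / h) *\<^sub>R p i \<in> span S" using pS by (intro span_scale span_base)
      then show ?thesis using mpos[OF True] \<open>h > 0\<close> by (simp add: p_def)
    qed (use WS span_base in blast)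
    then have "x \<in> span S" for x by (subst expand[of x]) (intro span_sum span_scale)
    then have "span S = UNIV" by blast
    then have "dim S = CARD('n)" by (metis dim_UNIV dim_span DIM_cart DIM_real mult.right_neutral)
    then show ?thesis using aff_dim_zero[of S] zS by (simp add: hull_inc)
  qed
  have "\<not> centrally_symmetric S"
  proof
    assume "centrally_symmetric S"
    then obtain c where c: "S = (\<lambda>x. 2 *\<^sub>R c - x) ` S" unfolding centrally_symmetric_def by blast
    then have refl: "2 *\<^sub>R c - x \<in> S" if "x \<in> S" for x using that by blast
    \<comment> \<open>The reflection exchanges 0 and \<open>2c\<close>, and maps each \<open>p i\<close> to a point with nonnegative
      coordinates. So \<open>2c\<close> dominates both \<open>p i0\<close> and \<open>p j0\<close> coordinatewise, and
      \<open>g\<close> is at least \<open>2h\<close> there.\<close>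
    let ?z = "2 *\<^sub>R c"
    have zP: "?z \<in> P" using refl[OF zS] by (simp add: S_def)
    have I: "i0 \<in> I" "j0 \<in> I" using ij by (auto simp: I_def m_def)
    have vz: "(v i \<bullet> ?z) / k * m i \<ge> h" if "i \<in> I" for i
    proof -
      have "0 \<le> v i \<bullet> (?z - p i)" using refl[OF pS[OF that]] by (simp add: S_def P_def)
      then have "h / m i * k \<le> v i \<bullet> ?z" by (simp add: inner_diff_right vp)
      then show ?thesis using mpos[OF that] \<open>k > 0\<close> by (simp add: field_simps)
    qed
    have "h + h \<le> (\<Sum>i\<in>{i0, j0}. (v i \<bullet> ?z) / k * m i)"
      using vz[OF I(1)] vz[OF I(2)] ij(1) by simp
    also have "\<dots> \<le> g \<bullet> ?z"
      unfolding g_expand using I zP mpos \<open>k > 0\<close>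
      by (intro sum_mono2) (auto simp: P_def less_imp_le)
    also have "\<dots> \<le> h" using zP by (simp add: P_def)
    finally show False using \<open>h > 0\<close> by simp
  qed
  moreover have "lattice_convex L S" unfolding lattice_convex_def S_def using \<open>convex P\<close> by blast
  moreover have "\<exists>a\<in>insert g (range v \<union> uminus ` range v). outer_normal a F (convex hull S)"
    if F: "F facet_of (convex hull S)" for F
  proof -
    have "aff_dim P = int (DIM(real^'n))"
      using \<open>aff_dim S = int CARD('n)\<close> hullS aff_dim_convex_hull[of S] by simp
    then have int: "interior P \<noteq> {}"
      using \<open>convex P\<close> zS by (auto simp: S_def interior_rel_interior_gen rel_interior_eq_empty)
    have vne: "v i \<noteq> 0" for i using vW[of i i] \<open>k > 0\<close> by auto
    have nz: "a \<noteq> 0" if "(a, b) \<in> H" for a b using that vne ij(2) by (auto simp: H_def)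
    have "finite H" by (simp add: H_def)
    have "F facet_of P" using F hullS by simp
    then have "\<exists>(a, b)\<in>H. F = P \<inter> {x. a \<bullet> x = b}"
      using nz by (intro facet_of_Int_halfspaces[OF \<open>finite H\<close> int PH]) blast+
    then obtain a b where ab: "(a, b) \<in> H" "F = P \<inter> {x. a \<bullet> x = b}" by blast
    have "P \<subseteq> {x. a \<bullet> x \<le> b}" using ab(1) PH by auto
    then have "outer_normal a F P" unfolding outer_normal_def using nz[OF ab(1)] ab(2) by blast
    moreover have "a \<in> insert g (range v \<union> uminus ` range v)" using ab(1) by (auto simp: H_def)
    ultimately show ?thesis using hullS by blast
  qed
  ultimately have "admissible L (insert g (range v \<union> uminus ` range v)) S"
    unfolding admissible_def using \<open>finite S\<close> \<open>aff_dim S = int CARD('n)\<close> S_def by blast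
  then show ?thesis by blast
qed

text \<open>
  Since \<open>g\<close> is not parallel to any \<open>v i\<close>, at least two of its coefficients with respect to \<open>v\<close> are
  nonzero. Replacing some of the \<open>v i\<close> and the dual directions by their negatives makes all coefficients
  nonnegative; the set of admitted normals is closed under negation, so this loses nothing.
\<close>

lemma exists_admissible:
  fixes L :: "(real^'n) set" and v :: "'n \<Rightarrow> real^'n" and g :: "real^'n"
  assumes L: "lattice_of_rank CARD('n) L"
    and v: "\<And>i. v i \<in> dual_lattice L" "inj v" "independent (range v)"
    and g: "g \<in> dual_lattice L" "\<And>i. \<not> parallel g (v i)"
  shows "\<exists>S. admissible L (\<Union>w\<in>insert g (range v). {w, - w}) S"
proof -
  obtain W k where W: "\<And>i. W i \<in> L" and "k > 0"
    and vW: "\<And>i j. v i \<bullet> W j = (if i = j then k else 0)"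
    using lattice_dual_directions[OF L v] by blast
  note span = span_range_eq_UNIV[OF v(2,3)]
  have two: "\<exists>i. i \<noteq> j \<and> g \<bullet> W i \<noteq> 0" for j
  proof (rule ccontr)
    assume none: "\<nexists>i. i \<noteq> j \<and> g \<bullet> W i \<noteq> 0"
    obtain f where "g = (\<Sum>w\<in>range v. f w *\<^sub>R w)"
      using span span_finite[of "range v"] by (auto simp: set_eq_iff image_iff)
    then have gsum: "g = (\<Sum>i\<in>UNIV. f (v i) *\<^sub>R v i)" using v(2) by (simp add: sum.reindex)
    have "g \<bullet> W i = f (v i) * k" for i
      unfolding gsum by (simp add: inner_sum_left vW if_distrib cong: if_cong)
    then have "f (v i) = 0" if "i \<noteq> j" for i using none that \<open>k > 0\<close> by auto
    then have "g = (\<Sum>i\<in>UNIV. if i = j then f (v j) *\<^sub>R v j else 0)"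
      unfolding gsum by (intro sum.cong) auto
    then have "g = f (v j) *\<^sub>R v j" by simp
    then show False using g(2)[of j] unfolding parallel_def by blast
  qed
  obtain i0 where i0: "g \<bullet> W i0 \<noteq> 0" using two by blast
  obtain j0 where j0: "j0 \<noteq> i0" "g \<bullet> W j0 \<noteq> 0" using two by blast
  \<comment> \<open>The signs that make all values of \<open>g\<close> on the dual directions nonnegative.\<close>
  define e :: "'n \<Rightarrow> real" where "e i = (if g \<bullet> W i < 0 then - 1 else 1)" for i
  have e: "e i = 1 \<or> e i = - 1" for i by (simp add: e_def)
  have vd: "e i *\<^sub>R v i \<in> dual_lattice L" for i
    using v(1)[of i] e[of i] by (auto simp: dual_lattice_def)
  have Wd: "e i *\<^sub>R W i \<in> L" for i
    using W[of i] e[of i] lattice_uminus[OF L W[of i]] by auto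
  have "\<exists>S. admissible L (insert g (range (\<lambda>i. e i *\<^sub>R v i) \<union> uminus ` range (\<lambda>i. e i *\<^sub>R v i))) S"
  proof (rule exists_admissible_simplex_prism[OF L vd g(1) Wd \<open>k > 0\<close>])
    show "(e i *\<^sub>R v i) \<bullet> (e j *\<^sub>R W j) = (if i = j then k else 0)" for i j
      using e[of i] by (auto simp: vW)
    show "0 \<le> g \<bullet> (e i *\<^sub>R W i)" for i by (simp add: e_def)
    show "i0 \<noteq> j0" using j0 by simp
    show "0 < g \<bullet> (e i0 *\<^sub>R W i0)" "0 < g \<bullet> (e j0 *\<^sub>R W j0)"
      using i0 j0 by (simp_all add: e_def)
  qed
  moreover have "insert g (range (\<lambda>i. e i *\<^sub>R v i) \<union> uminus ` range (\<lambda>i. e i *\<^sub>R v i))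
      \<subseteq> (\<Union>w\<in>insert g (range v). {w, - w})"
  proof -
    have "e i *\<^sub>R v i \<in> {v i, - v i}" "- (e i *\<^sub>R v i) \<in> {v i, - v i}" for i
      using e[of i] by auto
    then show ?thesis by blast
  qed
  ultimately show ?thesis using admissible_mono by blast
qed

section \<open>Nontrivially homometric lattice-convex sets\<close>

theorem corollary2p2:
  fixes M L T :: "(real^'n) set" and u :: "nat \<Rightarrow> real^'n"
  assumes "(M, L, T) \<in> tiling_triples"
    and "\<not> centrally_symmetric T"
    and "\<And>i. i \<in> {1..CARD('n) + 1} \<Longrightarrow> u i \<in> small_width_vectors T L"
    and "inj_on u {1..CARD('n)}" and "independent (u ` {1..CARD('n)})"
    and "\<And>i. i \<in> {1..CARD('n)} \<Longrightarrow> \<not> parallel (u (CARD('n) + 1)) (u i)"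
  shows "(\<exists>S. admissible L (\<Union>i\<in>{1..CARD('n) + 1}. {u i, - u i}) S) \<and>
         (\<forall>S. admissible L (\<Union>i\<in>{1..CARD('n) + 1}. {u i, - u i}) S \<longrightarrow>
            direct_sum S T \<and> direct_sum S (uminus ` T) \<and>
            lattice_convex M (S + T) \<and> lattice_convex M (S + uminus ` T) \<and>
            nontrivially_homometric (S + T) (S + uminus ` T))"
proof (intro conjI allI impI)
  let ?d = "CARD('n)"
  let ?N = "\<Union>i\<in>{1..?d + 1}. {u i, - u i}"
  have M: "lattice_of_rank ?d M" and L: "lattice_of_rank ?d L" and T: "T \<noteq> {}" "finite T"
    and dir: "direct_sum L T" and MLT: "M = L + T"
    using assms(1) unfolding tiling_triples_def by auto
  have dual: "u i \<in> dual_lattice L" if "i \<in> {1..?d + 1}" for i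
    using assms(3)[OF that] by (simp add: small_width_vectors_def)
  show "\<exists>S. admissible L ?N S"
  proof -
    obtain \<sigma> :: "'n \<Rightarrow> nat" where \<sigma>: "bij_betw \<sigma> UNIV {1..?d}"
      using finite_same_card_bij[of "UNIV :: 'n set" "{1..?d}"] by auto
    then have \<sigma>_in: "\<sigma> i \<in> {1..?d}" for i by (auto simp: bij_betw_def)
    have range: "range (u \<circ> \<sigma>) = u ` {1..?d}" 
      using \<sigma> image_comp[of u \<sigma> UNIV] by (simp add: bij_betw_def)
    have "\<exists>S. admissible L (\<Union>w\<in>insert (u (?d + 1)) (range (u \<circ> \<sigma>)). {w, - w}) S"
    proof (rule exists_admissible[OF L])
      show "(u \<circ> \<sigma>) i \<in> dual_lattice L" for i using dual[of "\<sigma> i"] \<sigma>_in[of i] by simp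
      show "inj (u \<circ> \<sigma>)" using \<sigma> assms(4) by (auto simp: bij_betw_def intro: comp_inj_on)
      show "independent (range (u \<circ> \<sigma>))" unfolding range by (rule assms(5))
      show "u (?d + 1) \<in> dual_lattice L" by (rule dual) simp
      show "\<not> parallel (u (?d + 1)) ((u \<circ> \<sigma>) i)" for i using assms(6)[OF \<sigma>_in] by simp
    qed
    moreover have "(\<Union>w\<in>insert (u (?d + 1)) (range (u \<circ> \<sigma>)). {w, - w}) \<subseteq> ?N"
      unfolding range by fastforce
    ultimately show ?thesis using admissible_mono by blast
  qed
  fix S assume S: "admissible L ?N S"
  then have SL: "S \<subseteq> L" and asym: "\<not> centrally_symmetric S" and finS: "finite S"
    and dimS: "aff_dim S = int ?d" and convS: "lattice_convex L S"
    and facets: "\<And>F. F facet_of (convex hull S) \<Longrightarrow> \<exists>v\<in>?N. outer_normal v F (convex hull S)"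
    unfolding admissible_def by auto
  have "S \<noteq> {}" using dimS by auto
  have "aff_dim (convex hull S) = int DIM(real^'n)" using dimS by (simp add: aff_dim_convex_hull)
  then have full: "interior (convex hull S) \<noteq> {}"
    using \<open>S \<noteq> {}\<close> by (simp add: interior_rel_interior_gen rel_interior_eq_empty)
  have NT: "?N \<subseteq> small_width_vectors T L"
    using assms(3) small_width_uminus(1)[OF T(2,1)] by blast
  then have NT': "?N \<subseteq> small_width_vectors (uminus ` T) L"
    using small_width_uminus(2)[OF T(2,1)] by blast
  show dirT: "direct_sum S T" using dir SL by (rule direct_sum_subset)
  then show "direct_sum S (uminus ` T)" by (rule direct_sum_uminus)
  show "lattice_convex M (S + T)"
    by (rule lattice_convex_sum[OF MLT T(2) SL finS convS full]) (use facets NT in blast)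
  \<comment> \<open>Lattices are symmetric about the origin, so \<open>-T\<close> tiles \<open>M\<close> by \<open>L\<close> just as \<open>T\<close> does.\<close>
  have "M = uminus ` M" using uminus_image_lattice[OF M] by simp
  also have "\<dots> = uminus ` L + uminus ` T" unfolding MLT by (force simp: set_plus_def image_def)
  also have "\<dots> = L + uminus ` T" using uminus_image_lattice[OF L] by simp
  finally have MLT': "M = L + uminus ` T" .
  show "lattice_convex M (S + uminus ` T)"
    by (rule lattice_convex_sum[OF MLT' finite_imageI[OF T(2)] SL finS convS full])
      (use facets NT' in blast)
  show "nontrivially_homometric (S + T) (S + uminus ` T)"
    by (rule nontrivially_homometric_direct_sums[OF finS T(2) \<open>S \<noteq> {}\<close> T(1) dirT asym assms(2)])
qed

end
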